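(* Let $n\ge 1$ be an integer. With $\sigma_1(1,n),\sigma_2(1,n)$ the $(n+1)\times(n+1)$ Pascal-type matrices and $\rho(n)$ the $(n+1)$-dimensional highest weight representation of $U(\mathfrak{sl}_2)$ defined in the context, one has $$\sigma_1(1,n)=\exp\left(\rho(n)(X)\right),\qquad \sigma_2(1,n)=\exp\left(\rho(n)(-Y)\right).$$
   Context: All matrices are complex of size $(n+1)\times(n+1)$, with rows and columns indexed by $0,1,\dots,n$. For a matrix $A=(a_{ij})_{0\le i,j\le n}$ put $A^\sharp=(a^\sharp_{ij})$ with $a^\sharp_{ij}=a_{n-i,n-j}$. The matrix $\sigma_1(1,n)$ is the upper triangular Pascal matrix with entries $\sigma_1(1,n)_{km}=\binom{n-k}{n-m}$ for $0\le k,m\le n$ (a binomial coefficient $\binom{a}{b}$ is $0$ when $b>a$). For example $\sigma_1(1,2)=\begin{pmatrix}1&2&1\\0&1&1\\0&0&1\end{pmatrix}$. The matrix $\sigma_2(1,n)$ is defined by $\sigma_2(1,n)=\left(\sigma_1(1,n)^{-1}\right)^\sharp$. $U(\mathfrak{sl}_2)$ is the associative algebra generated by $X,Y,H$ with relations $[H,X]=2X$, $[H,Y]=-2Y$, $[X,Y]=H$. The representation $\rho(n)$ of $U(\mathfrak{sl}_2)$ on $\mathbb C^{n+1}$ is given as follows: $\rho(n)(X)$ has entries $n,n-1,\dots,1$ on the first superdiagonal, that is, $\rho(n)(X)_{k,k+1}=n-k$ for $0\le k\le n-1$, and zeros elsewhere; $\rho(n)(Y)$ has entries $1,2,\dots,n$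 on the first subdiagonal, that is, $\rho(n)(Y)_{k,k-1}=k$ for $1\le k\le n$, and zeros elsewhere; $\rho(n)(H)=\mathrm{diag}(n,n-2,\dots,-n+2,-n)$. Here $\exp$ is the usual matrix exponential. *)

theory Defs
  imports Complex_Main "Jordan_Normal_Form.Determinant"
begin

text \<open>All matrices are elements of \<open>complex mat\<close> of dimension \<open>(n + 1) \<times> (n + 1)\<close>; rows and
  columns are indexed from \<open>0\<close> to \<open>n\<close>.\<close>

section \<open>The Pascal-type matrices\<close>

definition sharp :: "'a mat \<Rightarrow> 'a mat" where
  "sharp A = mat (dim_row A) (dim_col A)
     (\<lambda>(i, j). A $$ (dim_row A - 1 - i, dim_col A - 1 - j))"

definition sigma1 :: "nat \<Rightarrow> complex mat" where
  "sigma1 n = mat (n + 1) (n + 1) (\<lambda>(k, m). of_nat ((n - k) choose (n - m)))"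

definition sigma2 :: "nat \<Rightarrow> complex mat" where
  "sigma2 n = sharp (the (mat_inverse (sigma1 n)))"

text \<open>The inverse in \<open>sigma2\<close> exists, so \<open>the\<close> is applied to a \<open>Some\<close>.\<close>

lemma sigma1_inverse:
  obtains B where "mat_inverse (sigma1 n) = Some B" "B \<in> carrier_mat (n + 1) (n + 1)"
    "sigma1 n * B = 1\<^sub>m (n + 1)" "B * sigma1 n = 1\<^sub>m (n + 1)"
proof -
  have c: "sigma1 n \<in> carrier_mat (n + 1) (n + 1)"
    by (simp add: sigma1_def)
  have ut: "upper_triangular (sigma1 n)"
    by (auto simp: upper_triangular_def sigma1_def)
  have "det (sigma1 n) = prod_list (diag_mat (sigma1 n))"
    by (rule det_upper_triangular[OF ut c])
  moreover have "0 \<notin> set (diag_mat (sigma1 n))"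
    by (auto simp: diag_mat_def sigma1_def)
  ultimately have "det (sigma1 n) \<noteq> 0"
    by (simp add: prod_list_zero_iff)
  hence "sigma1 n \<in> Units (ring_mat TYPE(complex) (n + 1) ())"
    by (rule det_non_zero_imp_unit[OF c])
  then obtain B where "mat_inverse (sigma1 n) = Some B"
    using mat_inverse(1)[OF c, where b = "()"] by (cases "mat_inverse (sigma1 n)") auto
  thus thesis
    using mat_inverse(2)[OF c] that by blast
qed

section \<open>The matrix exponential\<close>

definition mat_exp :: "complex mat \<Rightarrow> complex mat" where
  "mat_exp A = mat (dim_row A) (dim_row A)
     (\<lambda>(i, j). \<Sum>k. (A ^\<^sub>m k) $$ (i, j) / fact k)"

lemma pow_mat_entry_bound:
  fixes A :: "complex mat"
  assumes A: "A \<in> carrier_mat d d"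
    and M: "\<And>i j. i < d \<Longrightarrow> j < d \<Longrightarrow> norm (A $$ (i, j)) \<le> M"
    and ij: "i < d" "j < d"
  shows "norm ((A ^\<^sub>m k) $$ (i, j)) \<le> (real d * M) ^ k"
  using ij(2)
proof (induction k arbitrary: j)
  case 0
  thus ?case using A ij(1) by auto
next
  case (Suc k)
  have M0: "0 \<le> M"
    using M[OF ij] norm_ge_zero order_trans by blast
  have "(A ^\<^sub>m Suc k) $$ (i, j) = (\<Sum>l\<in>{0..<d}. (A ^\<^sub>m k) $$ (i, l) * A $$ (l, j))"
    using A ij(1) Suc.prems by (auto simp: scalar_prod_def)
  also have "norm \<dots> \<le> (\<Sum>l\<in>{0..<d}. (real d * M) ^ k * M)"
  proof (rule sum_norm_le)
    fix l assume "l \<in> {0..<d}"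
    hence l: "l < d" by simp
    show "norm ((A ^\<^sub>m k) $$ (i, l) * A $$ (l, j)) \<le> (real d * M) ^ k * M"
      unfolding norm_mult
      by (rule mult_mono[OF Suc.IH[OF l] M[OF l Suc.prems]]) (use M0 in auto)
  qed
  also have "\<dots> = (real d * M) ^ Suc k" by simp
  finally show ?case .
qed

text \<open>The exponential series converges entrywise for every square matrix, so the \<open>suminf\<close> in
  \<open>mat_exp\<close> is never a default value.\<close>

lemma mat_exp_sums:
  fixes A :: "complex mat"
  assumes A: "A \<in> carrier_mat d d" and ij: "i < d" "j < d"
  shows "(\<lambda>k. (A ^\<^sub>m k) $$ (i, j) / fact k) sums (mat_exp A $$ (i, j))"
proof -
  define M where "M = (\<Sum>p\<in>{0..<d} \<times> {0..<d}. norm (A $$ p))"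
  have M: "norm (A $$ (i, j)) \<le> M" if "i < d" "j < d" for i j
    unfolding M_def by (rule member_le_sum) (use that in auto)
  have "summable (\<lambda>k. (A ^\<^sub>m k) $$ (i, j) / fact k)"
  proof (rule summable_comparison_test'[where N = 0])
    show "summable (\<lambda>k. inverse (fact k) * (real d * M) ^ k)"
      by (rule summable_exp)
    show "norm ((A ^\<^sub>m k) $$ (i, j) / fact k) \<le> inverse (fact k) * (real d * M) ^ k" for k
      using pow_mat_entry_bound[OF A M ij, of k]
      by (simp add: norm_divide divide_simps)
  qed
  thus ?thesis
    using A ij by (auto simp: mat_exp_def summable_sums)
qed

section \<open>The algebra \<open>U(sl\<^sub>2)\<close>\<close>

text \<open>The presented algebra is built as in universal algebra: formal algebra expressions in the
  three generators, modulo the least congruence containing the laws of unital associative complex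
  algebras and the defining relations. \<open>Const c\<close> stands for \<open>c\<close> times the unit.\<close>

datatype uexp =
    GenX | GenY | GenH
  | Const complex
  | Plus uexp uexp
  | Times uexp uexp

abbreviation Neg :: "uexp \<Rightarrow> uexp" where
  "Neg a \<equiv> Times (Const (- 1)) a"

abbreviation Comm :: "uexp \<Rightarrow> uexp \<Rightarrow> uexp" where
  "Comm a b \<equiv> Plus (Times a b) (Neg (Times b a))"

inductive ueq :: "uexp \<Rightarrow> uexp \<Rightarrow> bool" where
  refl: "ueq a a"
| sym: "ueq a b \<Longrightarrow> ueq b a"
| trans: "ueq a b \<Longrightarrow> ueq b c \<Longrightarrow> ueq a c"
| cong_plus: "ueq a a' \<Longrightarrow> ueq b b' \<Longrightarrow> ueq (Plus a b) (Plus a' b')"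
| cong_times: "ueq a a' \<Longrightarrow> ueq b b' \<Longrightarrow> ueq (Times a b) (Times a' b')"
| plus_assoc: "ueq (Plus (Plus a b) c) (Plus a (Plus b c))"
| plus_comm: "ueq (Plus a b) (Plus b a)"
| plus_zero: "ueq (Plus (Const 0) a) a"
| plus_neg: "ueq (Plus (Neg a) a) (Const 0)"
| times_assoc: "ueq (Times (Times a b) c) (Times a (Times b c))"
| one_times: "ueq (Times (Const 1) a) a"
| times_one: "ueq (Times a (Const 1)) a"
| distrib_right: "ueq (Times (Plus a b) c) (Plus (Times a c) (Times b c))"
| distrib_left: "ueq (Times a (Plus b c)) (Plus (Times a b) (Times a c))"
| const_plus: "ueq (Plus (Const s) (Const t)) (Const (s + t))"
| const_times: "ueq (Times (Const s) (Const t)) (Const (s * t))"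
| const_central: "ueq (Times (Const s) a) (Times a (Const s))"
| rel_HX: "ueq (Comm GenH GenX) (Times (Const 2) GenX)"
| rel_HY: "ueq (Comm GenH GenY) (Times (Const (- 2)) GenY)"
| rel_XY: "ueq (Comm GenX GenY) GenH"

quotient_type usl2 = uexp / ueq
  by (rule equivpI) (auto intro: reflpI sympI transpI ueq.intros(1-3))

primrec counit_exp :: "uexp \<Rightarrow> complex" where
  "counit_exp GenX = 0"
| "counit_exp GenY = 0"
| "counit_exp GenH = 0"
| "counit_exp (Const c) = c"
| "counit_exp (Plus a b) = counit_exp a + counit_exp b"
| "counit_exp (Times a b) = counit_exp a * counit_exp b"

lemma ueq_counit_exp: "ueq a b \<Longrightarrow> counit_exp a = counit_exp b"
  by (induction rule: ueq.induct) (auto simp: algebra_simps)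

instantiation usl2 :: ring_1
begin

lift_definition zero_usl2 :: usl2 is "Const 0" .
lift_definition one_usl2 :: usl2 is "Const 1" .
lift_definition plus_usl2 :: "usl2 \<Rightarrow> usl2 \<Rightarrow> usl2" is Plus by (rule ueq.cong_plus)
lift_definition times_usl2 :: "usl2 \<Rightarrow> usl2 \<Rightarrow> usl2" is Times by (rule ueq.cong_times)
lift_definition uminus_usl2 :: "usl2 \<Rightarrow> usl2" is Neg by (intro ueq.cong_times ueq.refl)
lift_definition minus_usl2 :: "usl2 \<Rightarrow> usl2 \<Rightarrow> usl2" is "\<lambda>a b. Plus a (Neg b)"
  by (intro ueq.cong_plus ueq.cong_times ueq.refl)

instance
proof
  fix a b c :: usl2
  show "a + b + c = a + (b + c)" by transfer (rule ueq.plus_assoc)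
  show "a + b = b + a" by transfer (rule ueq.plus_comm)
  show "0 + a = a" by transfer (rule ueq.plus_zero)
  show "- a + a = 0" by transfer (rule ueq.plus_neg)
  show "a - b = a + - b" by transfer (rule ueq.refl)
  show "a * b * c = a * (b * c)" by transfer (rule ueq.times_assoc)
  show "1 * a = a" by transfer (rule ueq.one_times)
  show "a * 1 = a" by transfer (rule ueq.times_one)
  show "(a + b) * c = a * c + b * c" by transfer (rule ueq.distrib_right)
  show "a * (b + c) = a * b + a * c" by transfer (rule ueq.distrib_left)
  show "(0 :: usl2) \<noteq> 1" by transfer (auto dest: ueq_counit_exp)
qed

end

lift_definition uX :: usl2 is GenX .
lift_definition uY :: usl2 is GenY .
lift_definition uH :: usl2 is GenH .

lift_definition uscale :: "complex \<Rightarrow> usl2 \<Rightarrow> usl2" is "\<lambda>c a. Times (Const c) a"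
  by (intro ueq.cong_times ueq.refl)

lemma usl2_relations:
  "uH * uX - uX * uH = uscale 2 uX"
  "uH * uY - uY * uH = uscale (- 2) uY"
  "uX * uY - uY * uX = uH"
  by (transfer, rule ueq.rel_HX, transfer, rule ueq.rel_HY, transfer, rule ueq.rel_XY)

section \<open>The representation \<open>\<rho>(n)\<close>\<close>

definition rhoX :: "nat \<Rightarrow> complex mat" where
  "rhoX n = mat (n + 1) (n + 1) (\<lambda>(i, j). if j = i + 1 then of_nat (n - i) else 0)"

definition rhoY :: "nat \<Rightarrow> complex mat" where
  "rhoY n = mat (n + 1) (n + 1) (\<lambda>(i, j). if i = j + 1 then of_nat i else 0)"

definition rhoH :: "nat \<Rightarrow> complex mat" where
  "rhoH n = mat (n + 1) (n + 1) (\<lambda>(i, j). if i = j then of_nat n - 2 * of_nat i else 0)"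

primrec rho_exp :: "nat \<Rightarrow> uexp \<Rightarrow> complex mat" where
  "rho_exp n GenX = rhoX n"
| "rho_exp n GenY = rhoY n"
| "rho_exp n GenH = rhoH n"
| "rho_exp n (Const c) = c \<cdot>\<^sub>m 1\<^sub>m (n + 1)"
| "rho_exp n (Plus a b) = rho_exp n a + rho_exp n b"
| "rho_exp n (Times a b) = rho_exp n a * rho_exp n b"

lemma rho_exp_carrier: "rho_exp n a \<in> carrier_mat (n + 1) (n + 1)"
  by (induction a) (auto simp: rhoX_def rhoY_def rhoH_def)

lemma const_mult_mat:
  fixes A :: "complex mat"
  assumes "A \<in> carrier_mat m m"
  shows "(c \<cdot>\<^sub>m 1\<^sub>m m) * A = c \<cdot>\<^sub>m A" "A * (c \<cdot>\<^sub>m 1\<^sub>m m) = c \<cdot>\<^sub>m A"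
proof -
  show "(c \<cdot>\<^sub>m 1\<^sub>m m) * A = c \<cdot>\<^sub>m A"
    using mult_smult_assoc_mat[OF one_carrier_mat assms, of c] left_mult_one_mat[OF assms]
    by (simp only:)
  show "A * (c \<cdot>\<^sub>m 1\<^sub>m m) = c \<cdot>\<^sub>m A"
    using mult_smult_distrib[OF assms one_carrier_mat, of c] right_mult_one_mat[OF assms]
    by (simp only:)
qed

lemma rho_relations:
  "rhoH n * rhoX n + (- 1 \<cdot>\<^sub>m 1\<^sub>m (n + 1)) * (rhoX n * rhoH n) = (2 \<cdot>\<^sub>m 1\<^sub>m (n + 1)) * rhoX n"
  "rhoH n * rhoY n + (- 1 \<cdot>\<^sub>m 1\<^sub>m (n + 1)) * (rhoY n * rhoH n) = (- 2 \<cdot>\<^sub>m 1\<^sub>m (n + 1)) * rhoY n"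
  "rhoX n * rhoY n + (- 1 \<cdot>\<^sub>m 1\<^sub>m (n + 1)) * (rhoY n * rhoX n) = rhoH n"
proof -
  have X: "rhoX n \<in> carrier_mat (n + 1) (n + 1)"
    and Y: "rhoY n \<in> carrier_mat (n + 1) (n + 1)"
    and H: "rhoH n \<in> carrier_mat (n + 1) (n + 1)"
    by (auto simp: rhoX_def rhoY_def rhoH_def)
  have sc: "(c \<cdot>\<^sub>m 1\<^sub>m (n + 1)) * A = c \<cdot>\<^sub>m A"
    if "A \<in> carrier_mat (n + 1) (n + 1)" for c :: complex and A
    by (rule const_mult_mat(1)[OF that])
  have entry: "(A * B) $$ (i, j) = (\<Sum>l\<in>{0..<n + 1}. A $$ (i, l) * B $$ (l, j))"
    if "A \<in> carrier_mat (n + 1) (n + 1)" "B \<in> carrier_mat (n + 1) (n + 1)" "i < n + 1" "j < n + 1"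
    for A B :: "complex mat" and i j
    using that by (auto simp: scalar_prod_def simp del: sum.op_ivl_Suc)
  have HA: "(rhoH n * A) $$ (i, j) = (of_nat n - 2 * of_nat i) * A $$ (i, j)"
    if "A \<in> carrier_mat (n + 1) (n + 1)" "i < n + 1" "j < n + 1" for A i j
  proof -
    have "(rhoH n * A) $$ (i, j)
        = (\<Sum>l\<in>{0..<n + 1}. (if i = l then (of_nat n - 2 * of_nat i) * A $$ (l, j) else 0))"
      unfolding entry[OF H that] using that by (intro sum.cong) (auto simp: rhoH_def)
    thus ?thesis using that(2) by (simp add: sum.delta del: sum.op_ivl_Suc)
  qed
  have AH: "(A * rhoH n) $$ (i, j) = A $$ (i, j) * (of_nat n - 2 * of_nat j)"
    if "A \<in> carrier_mat (n + 1) (n + 1)" "i < n + 1" "j < n + 1" for A i j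
  proof -
    have "(A * rhoH n) $$ (i, j)
        = (\<Sum>l\<in>{0..<n + 1}. (if l = j then A $$ (i, l) * (of_nat n - 2 * of_nat l) else 0))"
      unfolding entry[OF that(1) H that(2,3)] using that by (intro sum.cong) (auto simp: rhoH_def)
    thus ?thesis using that(3) by (simp add: sum.delta del: sum.op_ivl_Suc)
  qed
  have XA: "(rhoX n * A) $$ (i, j) = (if i < n then of_nat (n - i) * A $$ (i + 1, j) else 0)"
    if "A \<in> carrier_mat (n + 1) (n + 1)" "i < n + 1" "j < n + 1" for A i j
  proof -
    have "(rhoX n * A) $$ (i, j)
        = (\<Sum>l\<in>{0..<n + 1}. (if l = i + 1 then of_nat (n - i) * A $$ (l, j) else 0))"
      unfolding entry[OF X that] using that by (intro sum.cong) (auto simp: rhoX_def)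
    thus ?thesis by (simp add: sum.delta del: sum.op_ivl_Suc)
  qed
  have YA: "(rhoY n * A) $$ (i, j) = (if 0 < i then of_nat i * A $$ (i - 1, j) else 0)"
    if "A \<in> carrier_mat (n + 1) (n + 1)" "i < n + 1" "j < n + 1" for A i j
  proof -
    have "(rhoY n * A) $$ (i, j)
        = (\<Sum>l\<in>{0..<n + 1}. (if l = i - 1 then if 0 < i then of_nat i * A $$ (l, j) else 0 else 0))"
      unfolding entry[OF Y that] using that by (intro sum.cong) (auto simp: rhoY_def)
    thus ?thesis using that(2) by (simp add: sum.delta del: sum.op_ivl_Suc)
  qed
  note HX = HA[OF X] and HY = HA[OF Y] and XH = AH[OF X] and YH = AH[OF Y]
    and XY = XA[OF Y] and YX = YA[OF X]
  show "rhoH n * rhoX n + (- 1 \<cdot>\<^sub>m 1\<^sub>m (n + 1)) * (rhoX n * rhoH n) = (2 \<cdot>\<^sub>m 1\<^sub>m (n + 1)) * rhoX n"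
    unfolding sc[OF X] sc[OF mult_carrier_mat[OF X H]]
  proof (rule eq_matI)
    fix i j assume "i < dim_row (2 \<cdot>\<^sub>m rhoX n)" "j < dim_col (2 \<cdot>\<^sub>m rhoX n)"
    hence ij: "i < n + 1" "j < n + 1" using X by auto
    have "(rhoH n * rhoX n + - 1 \<cdot>\<^sub>m (rhoX n * rhoH n)) $$ (i, j)
        = (rhoH n * rhoX n) $$ (i, j) - (rhoX n * rhoH n) $$ (i, j)"
      using ij X H by (auto simp del: index_mult_mat(1))
    also have "\<dots> = (2 \<cdot>\<^sub>m rhoX n) $$ (i, j)"
      unfolding HX[OF ij] XH[OF ij] using ij by (auto simp: rhoX_def algebra_simps)
    finally show "(rhoH n * rhoX n + - 1 \<cdot>\<^sub>m (rhoX n * rhoH n)) $$ (i, j) = (2 \<cdot>\<^sub>m rhoX n) $$ (i, j)" .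
  qed (use X H in auto)
  show "rhoH n * rhoY n + (- 1 \<cdot>\<^sub>m 1\<^sub>m (n + 1)) * (rhoY n * rhoH n) = (- 2 \<cdot>\<^sub>m 1\<^sub>m (n + 1)) * rhoY n"
    unfolding sc[OF Y] sc[OF mult_carrier_mat[OF Y H]]
  proof (rule eq_matI)
    fix i j assume "i < dim_row (- 2 \<cdot>\<^sub>m rhoY n)" "j < dim_col (- 2 \<cdot>\<^sub>m rhoY n)"
    hence ij: "i < n + 1" "j < n + 1" using Y by auto
    have "(rhoH n * rhoY n + - 1 \<cdot>\<^sub>m (rhoY n * rhoH n)) $$ (i, j)
        = (rhoH n * rhoY n) $$ (i, j) - (rhoY n * rhoH n) $$ (i, j)"
      using ij Y H by (auto simp del: index_mult_mat(1))
    also have "\<dots> = (- 2 \<cdot>\<^sub>m rhoY n) $$ (i, j)"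
      unfolding HY[OF ij] YH[OF ij] using ij by (auto simp: rhoY_def algebra_simps)
    finally show "(rhoH n * rhoY n + - 1 \<cdot>\<^sub>m (rhoY n * rhoH n)) $$ (i, j) = (- 2 \<cdot>\<^sub>m rhoY n) $$ (i, j)" .
  qed (use Y H in auto)
  show "rhoX n * rhoY n + (- 1 \<cdot>\<^sub>m 1\<^sub>m (n + 1)) * (rhoY n * rhoX n) = rhoH n"
    unfolding sc[OF mult_carrier_mat[OF Y X]]
  proof (rule eq_matI)
    fix i j assume "i < dim_row (rhoH n)" "j < dim_col (rhoH n)"
    hence ij: "i < n + 1" "j < n + 1" using H by auto
    have "(rhoX n * rhoY n + - 1 \<cdot>\<^sub>m (rhoY n * rhoX n)) $$ (i, j)
        = (rhoX n * rhoY n) $$ (i, j) - (rhoY n * rhoX n) $$ (i, j)"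
      using ij X Y by (auto simp del: index_mult_mat(1))
    also have "\<dots> = rhoH n $$ (i, j)"
    proof -
      from ij(1) obtain k where k: "n = i + k"
        using less_imp_add_positive[of i "n + 1"] by (metis Suc_eq_plus1 less_Suc_eq_le le_iff_add)
      show ?thesis
      proof (cases i)
        case 0
        thus ?thesis
          unfolding XY[OF ij] YX[OF ij] using ij k
          by (auto simp: rhoX_def rhoY_def rhoH_def)
      next
        case (Suc m)
        have "Suc m + k - m = k + 1" by simp
        thus ?thesis
          unfolding XY[OF ij] YX[OF ij] using ij k Suc
          by (cases "i = j") (auto simp: rhoX_def rhoY_def rhoH_def ring_distribs)
      qed
    qed
    finally show "(rhoX n * rhoY n + - 1 \<cdot>\<^sub>m (rhoY n * rhoX n)) $$ (i, j) = rhoH n $$ (i, j)" .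
  qed (use X Y H in auto)
qed

lemma ueq_rho_exp: "ueq a b \<Longrightarrow> rho_exp n a = rho_exp n b"
proof (induction rule: ueq.induct)
  case (plus_assoc a b c)
  show ?case
    unfolding rho_exp.simps by (rule assoc_add_mat) (rule rho_exp_carrier)+
next
  case (plus_comm a b)
  show ?case
    unfolding rho_exp.simps by (rule comm_add_mat) (rule rho_exp_carrier)+
next
  case (plus_zero a)
  show ?case
    unfolding rho_exp.simps using rho_exp_carrier[of n a] by (intro eq_matI) auto
next
  case (plus_neg a)
  show ?case
    unfolding rho_exp.simps const_mult_mat[OF rho_exp_carrier]
    using rho_exp_carrier[of n a] by (intro eq_matI) auto
next
  case (times_assoc a b c)
  show ?case
    unfolding rho_exp.simps by (rule assoc_mult_mat) (rule rho_exp_carrier)+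
next
  case (one_times a)
  show ?case
    unfolding rho_exp.simps const_mult_mat[OF rho_exp_carrier] by (intro eq_matI) auto
next
  case (times_one a)
  show ?case
    unfolding rho_exp.simps const_mult_mat[OF rho_exp_carrier] by (intro eq_matI) auto
next
  case (distrib_right a b c)
  show ?case
    unfolding rho_exp.simps by (rule add_mult_distrib_mat) (rule rho_exp_carrier)+
next
  case (distrib_left a b c)
  show ?case
    unfolding rho_exp.simps by (rule mult_add_distrib_mat) (rule rho_exp_carrier)+
next
  case (const_plus s t)
  show ?case
    unfolding rho_exp.simps by (intro eq_matI) (auto simp: algebra_simps)
next
  case (const_times s t)
  have one: "t \<cdot>\<^sub>m 1\<^sub>m (n + 1) \<in> carrier_mat (n + 1) (n + 1)" by simp
  show ?case
    unfolding rho_exp.simps const_mult_mat(1)[OF one] by (intro eq_matI) auto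
next
  case (const_central s a)
  show ?case
    unfolding rho_exp.simps const_mult_mat[OF rho_exp_carrier] ..
next
  case rel_HX
  show ?case unfolding rho_exp.simps by (rule rho_relations(1))
next
  case rel_HY
  show ?case unfolding rho_exp.simps by (rule rho_relations(2))
next
  case rel_XY
  show ?case unfolding rho_exp.simps by (rule rho_relations(3))
qed simp_all

lift_definition rho :: "nat \<Rightarrow> usl2 \<Rightarrow> complex mat" is rho_exp
  by (rule ueq_rho_exp)

text \<open>\<open>rho n\<close> is the homomorphism of unital complex algebras with the prescribed values on the
  generators.\<close>

lemma rho_hom:
  "rho n a \<in> carrier_mat (n + 1) (n + 1)"
  "rho n (a + b) = rho n a + rho n b"
  "rho n (a * b) = rho n a * rho n b"
  "rho n (uscale c a) = c \<cdot>\<^sub>m rho n a"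
  "rho n 1 = 1\<^sub>m (n + 1)"
  "rho n uX = rhoX n"
  "rho n uY = rhoY n"
  "rho n uH = rhoH n"
proof -
  show "rho n a \<in> carrier_mat (n + 1) (n + 1)" by transfer (rule rho_exp_carrier)
  show "rho n (uscale c a) = c \<cdot>\<^sub>m rho n a"
  proof transfer
    fix n c a
    show "rho_exp n (Times (Const c) a) = c \<cdot>\<^sub>m rho_exp n a"
      unfolding rho_exp.simps by (rule const_mult_mat(1)[OF rho_exp_carrier])
  qed
  show "rho n 1 = 1\<^sub>m (n + 1)" by transfer (unfold rho_exp.simps, intro eq_matI, auto)
qed (transfer, simp only: rho_exp.simps)+

end

(* Since rho(X) is a weighted shift, the powers of c rho(X) have a single nonzero diagonal, and
   exp (c rho(X)) is the Pascal matrix with entries c^(m-k) * binom(n-k, n-m). By the binomial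
   theorem these matrices form a one-parameter group in c, so the inverse of sigma_1 is the matrix
   for c = -1. Finally, the flip A |-> sharp A is an algebra automorphism exchanging rho(X) and
   rho(Y), hence it commutes with exp and gives the formula for sigma_2. *)
theory Submission
  imports Defs
begin

text \<open>For \<open>m < k\<close> the truncated exponent is 0, but then the binomial coefficient
  vanishes, so the formula is also correct below the diagonal.\<close>

definition pascal :: "complex \<Rightarrow> nat \<Rightarrow> complex mat" where
  "pascal c n = mat (n + 1) (n + 1) (\<lambda>(k, m). c ^ (m - k) * of_nat ((n - k) choose (n - m)))"

lemma pascal_carrier [simp]: "pascal c n \<in> carrier_mat (n + 1) (n + 1)"
  by (simp add: pascal_def)

lemma pascal_one: "pascal 1 n = sigma1 n"
  by (simp add: pascal_def sigma1_def)

lemma pascal_zero: "pascal 0 n = 1\<^sub>m (n + 1)"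
  by (intro eq_matI) (auto simp: pascal_def power_0_left)

text \<open>Trinomial revision rewrites the two binomial coefficients as
  \<open>(n - i) choose (n - j)\<close>, free of the summation index, times
  \<open>(j - i) choose r\<close> with \<open>r = l - i\<close>. What remains is the binomial
  expansion of \<open>(s + t) ^ (j - i)\<close>.\<close>

lemma pascal_mult: "pascal s n * pascal t n = pascal (s + t) n"
proof (rule eq_matI)
  fix i j assume "i < dim_row (pascal (s + t) n)" "j < dim_col (pascal (s + t) n)"
  hence ij: "i \<le> n" "j \<le> n" by (auto simp: pascal_def)
  define f where "f l = s ^ (l - i) * of_nat ((n - i) choose (n - l)) *
      (t ^ (j - l) * of_nat ((n - l) choose (n - j)))" for l
  have prod: "(pascal s n * pascal t n) $$ (i, j) = (\<Sum>l\<in>{0..<n + 1}. f l)"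
    using ij by (auto simp: pascal_def scalar_prod_def f_def simp del: sum.op_ivl_Suc)
  \<comment> \<open>The first coefficient vanishes for \<open>l < i\<close>, the second for
    \<open>j < l\<close>. The bound \<open>l <= n\<close> keeps \<open>n - l\<close> from
    truncating.\<close>
  have f0: "f l = 0" if "l < i \<or> j < l" "l \<le> n" for l
    using that ij by (auto simp: f_def)
  show "(pascal s n * pascal t n) $$ (i, j) = pascal (s + t) n $$ (i, j)"
  proof (cases "i \<le> j")
    case False
    hence "(\<Sum>l\<in>{0..<n + 1}. f l) = 0"
      by (intro sum.neutral) (auto intro!: f0)
    thus ?thesis
      unfolding prod using False ij by (simp add: pascal_def)
  next
    case True
    have "(\<Sum>l\<in>{0..<n + 1}. f l) = (\<Sum>l\<in>{i..j}. f l)"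
      using ij by (intro sum.mono_neutral_right) (auto intro!: f0)
    also have "\<dots> = (\<Sum>r\<le>j - i. f (r + i))"
      by (rule sum.reindex_bij_witness[of _ "\<lambda>r. r + i" "\<lambda>l. l - i"]) (use True in auto)
    also have "\<dots> = (\<Sum>r\<le>j - i. of_nat ((n - i) choose (n - j)) *
        (of_nat ((j - i) choose r) * s ^ r * t ^ (j - i - r)))"
    proof (rule sum.cong[OF HOL.refl])
      fix r assume "r \<in> {..j - i}"
      hence r: "r \<le> j - i" by simp
      have "((n - i) choose (n - (r + i))) * ((n - (r + i)) choose (n - j))
          = ((n - i) choose (n - j)) * ((n - i - (n - j)) choose (n - (r + i) - (n - j)))"
        by (rule choose_mult) (use r ij True in auto)
      also have "(n - i - (n - j)) choose (n - (r + i) - (n - j)) = (j - i) choose (j - i - r)"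
        using r ij True by (intro arg_cong2[where f = binomial]) auto
      also have "\<dots> = (j - i) choose r"
        using binomial_symmetric[OF r] by simp
      finally have "of_nat ((n - i) choose (n - (r + i))) * of_nat ((n - (r + i)) choose (n - j))
          = (of_nat ((n - i) choose (n - j)) * of_nat ((j - i) choose r) :: complex)"
        by (metis of_nat_mult)
      moreover have "j - (r + i) = j - i - r" by simp
      ultimately show "f (r + i) = of_nat ((n - i) choose (n - j)) *
          (of_nat ((j - i) choose r) * s ^ r * t ^ (j - i - r))"
        unfolding f_def by (simp add: mult_ac)
    qed
    also have "\<dots> = of_nat ((n - i) choose (n - j)) * (s + t) ^ (j - i)"
      by (simp add: binomial_ring sum_distrib_left)
    finally show ?thesis
      unfolding prod using ij by (simp add: pascal_def)
  qed
qed (auto simp: pascal_def)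

text \<open>\<open>sigma1_inverse\<close> supplies a left inverse, \<open>pascal_mult\<close> at 1
  and -1 a right inverse, and the two must agree.\<close>

lemma mat_inverse_sigma1: "mat_inverse (sigma1 n) = Some (pascal (- 1) n)"
proof -
  obtain B where B: "mat_inverse (sigma1 n) = Some B" "B \<in> carrier_mat (n + 1) (n + 1)"
      "B * sigma1 n = 1\<^sub>m (n + 1)"
    by (rule sigma1_inverse)
  have "sigma1 n * pascal (- 1) n = 1\<^sub>m (n + 1)"
    using pascal_mult[of 1 n "- 1"] by (simp add: pascal_one pascal_zero)
  hence "B = B * (sigma1 n * pascal (- 1) n)"
    using B(2) by (simp only: right_mult_one_mat)
  also have "\<dots> = (B * sigma1 n) * pascal (- 1) n"
    by (rule assoc_mult_mat[symmetric, OF B(2) _ pascal_carrier]) (simp add: sigma1_def)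
  also have "\<dots> = pascal (- 1) n"
    unfolding B(3) by (rule left_mult_one_mat[OF pascal_carrier])
  finally show ?thesis using B(1) by simp
qed

text \<open>The quotient of factorials is the product of the \<open>k\<close> consecutive weights
  \<open>n - i\<close>, \<open>n - i - 1\<close>, ..., \<open>n - j + 1\<close> along the
  superdiagonal.\<close>

lemma pow_smult_rhoX:
  assumes "i \<le> n" "j \<le> n"
  shows "((c \<cdot>\<^sub>m rhoX n) ^\<^sub>m k) $$ (i, j)
    = (if j = i + k then c ^ k * fact (n - i) / fact (n - j) else 0)"
  using assms(2)
proof (induction k arbitrary: j)
  case 0
  thus ?case using assms(1) by (auto simp: rhoX_def)
next
  case (Suc k)
  define A where "A = c \<cdot>\<^sub>m rhoX n"
  have A: "A \<in> carrier_mat (n + 1) (n + 1)" by (simp add: A_def rhoX_def)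
  have "(A ^\<^sub>m Suc k) $$ (i, j) = (\<Sum>l\<in>{0..<n + 1}. (A ^\<^sub>m k) $$ (i, l) * A $$ (l, j))"
    using A assms(1) Suc.prems by (auto simp: scalar_prod_def simp del: sum.op_ivl_Suc)
  also have "\<dots> = (\<Sum>l\<in>{0..<n + 1}. if l = i + k then
      (if j = Suc (i + k) then c ^ Suc k * fact (n - i) / fact (n - j) else 0) else 0)"
  proof (rule sum.cong[OF HOL.refl])
    fix l assume "l \<in> {0..<n + 1}"
    hence l: "l \<le> n" by simp
    \<comment> \<open>This cancels the weight \<open>n - l\<close> of the entry
      \<open>(l, l + 1)\<close> against the denominator from the induction hypothesis. The case
      \<open>l = n\<close> does not arise, since \<open>j = l + 1\<close> would exceed
      \<open>n\<close>.\<close>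
    have fact_step: "fact (n - l) = of_nat (n - l) * (fact (n - Suc l) :: complex)" if "l < n"
      using that by (metis Suc_diff_Suc fact_Suc)
    show "(A ^\<^sub>m k) $$ (i, l) * A $$ (l, j) = (if l = i + k then
        (if j = Suc (i + k) then c ^ Suc k * fact (n - i) / fact (n - j) else 0) else 0)"
      using Suc.IH[OF l] Suc.prems l fact_step by (auto simp: A_def rhoX_def)
  qed
  \<comment> \<open>If \<open>i + k > n\<close>, the sum has no term at \<open>i + k\<close>; both
    sides are 0 because \<open>j <= n\<close>.\<close>
  also have "\<dots> = (if j = i + Suc k then c ^ Suc k * fact (n - i) / fact (n - j) else 0)"
    using Suc.prems by (simp add: sum.delta del: sum.op_ivl_Suc)
  finally show ?case by (simp add: A_def)
qed

lemma mat_exp_smult_rhoX: "mat_exp (c \<cdot>\<^sub>m rhoX n) = pascal c n"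
proof (rule eq_matI)
  fix i j assume "i < dim_row (pascal c n)" "j < dim_col (pascal c n)"
  hence ij: "i \<le> n" "j \<le> n" by (auto simp: pascal_def)
  \<comment> \<open>The exponential series has at most one nonzero term per entry. For
    \<open>j < i\<close> the truncated \<open>j - i\<close> is 0, and both sides vanish.\<close>
  have "((c \<cdot>\<^sub>m rhoX n) ^\<^sub>m k) $$ (i, j) / fact k
      = (if k = j - i then pascal c n $$ (i, j) else 0)" for k
  proof (cases "i \<le> j")
    case True
    have "((n - i) choose (n - j)) = (fact (n - i) / (fact (n - j) * fact (j - i)) :: complex)"
      using binomial_fact[of "n - j" "n - i", where 'a = complex] True ij by simp
    thus ?thesis
      unfolding pow_smult_rhoX[OF ij] using True ij by (auto simp: pascal_def)
  next
    case False
    thus ?thesis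
      unfolding pow_smult_rhoX[OF ij] using ij by (auto simp: pascal_def)
  qed
  thus "mat_exp (c \<cdot>\<^sub>m rhoX n) $$ (i, j) = pascal c n $$ (i, j)"
    using mat_exp_sums[of "c \<cdot>\<^sub>m rhoX n" "n + 1" i j] ij
      sums_single[of "j - i" "\<lambda>_. pascal c n $$ (i, j)"]
    by (intro sums_unique2[of "\<lambda>k. ((c \<cdot>\<^sub>m rhoX n) ^\<^sub>m k) $$ (i, j) / fact k"])
      (auto simp: rhoX_def)
qed (auto simp: pascal_def mat_exp_def rhoX_def)

lemma sharp_carrier [simp]: "A \<in> carrier_mat d e \<Longrightarrow> sharp A \<in> carrier_mat d e"
  by (auto simp: sharp_def)

lemma sharp_index:
  "A \<in> carrier_mat d e \<Longrightarrow> i < d \<Longrightarrow> j < e \<Longrightarrow> sharp A $$ (i, j) = A $$ (d - 1 - i, e - 1 - j)"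
  by (auto simp: sharp_def)

lemma sharp_mult:
  fixes A B :: "'a :: semiring_0 mat"
  assumes A: "A \<in> carrier_mat d e" and B: "B \<in> carrier_mat e f"
  shows "sharp (A * B) = sharp A * sharp B"
proof (rule eq_matI)
  fix i j assume "i < dim_row (sharp A * sharp B)" "j < dim_col (sharp A * sharp B)"
  hence ij: "i < d" "j < f" using A B by (auto simp: sharp_def)
  have "sharp (A * B) $$ (i, j)
      = (\<Sum>l\<in>{0..<e}. A $$ (d - 1 - i, l) * B $$ (l, f - 1 - j))"
    using A B ij by (simp add: sharp_index[OF mult_carrier_mat[OF A B]] scalar_prod_def)
  \<comment> \<open>The flip reverses the inner index too, so the sum is reindexed by the involution
    \<open>l -> e - 1 - l\<close>.\<close>
  also have "\<dots> = (\<Sum>l\<in>{0..<e}. A $$ (d - 1 - i, e - 1 - l) * B $$ (e - 1 - l, f - 1 - j))"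
    by (rule sum.reindex_bij_witness[of _ "\<lambda>l. e - 1 - l" "\<lambda>l. e - 1 - l"]) auto
  also have "\<dots> = (\<Sum>l\<in>{0..<e}. sharp A $$ (i, l) * sharp B $$ (l, j))"
    using ij by (intro sum.cong) (auto simp: sharp_index[OF A] sharp_index[OF B])
  also have "\<dots> = (sharp A * sharp B) $$ (i, j)"
    using ij sharp_carrier[OF A] sharp_carrier[OF B] by (simp add: scalar_prod_def)
  finally show "sharp (A * B) $$ (i, j) = (sharp A * sharp B) $$ (i, j)" .
qed (auto simp: sharp_def)

lemma sharp_one: "sharp (1\<^sub>m d) = 1\<^sub>m d"
  by (rule eq_matI) (auto simp: sharp_def)

lemma sharp_pow:
  fixes A :: "'a :: semiring_1 mat"
  assumes A: "A \<in> carrier_mat d d"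
  shows "sharp (A ^\<^sub>m k) = sharp A ^\<^sub>m k"
proof (induction k)
  case 0
  show ?case using A by (simp add: sharp_one sharp_def[of A])
next
  case (Suc k)
  thus ?case using sharp_mult[OF pow_carrier_mat[OF A] A] by simp
qed

text \<open>The flip only permutes entries and \<open>mat_exp\<close> is an entrywise series, so by
  \<open>sharp_pow\<close> both sides are the same series term by term; no limit argument
  enters.\<close>

lemma sharp_mat_exp:
  assumes A: "A \<in> carrier_mat d d"
  shows "sharp (mat_exp A) = mat_exp (sharp A)"
proof (rule eq_matI)
  fix i j assume "i < dim_row (mat_exp (sharp A))" "j < dim_col (mat_exp (sharp A))"
  hence ij: "i < d" "j < d" using A by (auto simp: mat_exp_def sharp_def)
  have "(sharp A ^\<^sub>m k) $$ (i, j) = (A ^\<^sub>m k) $$ (d - 1 - i, d - 1 - j)" for k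
    using sharp_index[OF pow_carrier_mat[OF A] ij] by (simp add: sharp_pow[OF A])
  thus "sharp (mat_exp A) $$ (i, j) = mat_exp (sharp A) $$ (i, j)"
    using A ij by (auto simp: mat_exp_def sharp_def)
qed (use A in \<open>auto simp: mat_exp_def sharp_def\<close>)

text \<open>The flip sends the subdiagonal position \<open>(i, i - 1)\<close> to
  \<open>(n - i, n - i + 1)\<close>, where \<open>rhoX n\<close> has weight
  \<open>n - (n - i) = i\<close>.\<close>

lemma sharp_smult_rhoX: "sharp (c \<cdot>\<^sub>m rhoX n) = c \<cdot>\<^sub>m rhoY n"
  by (rule eq_matI) (auto simp: sharp_def rhoX_def rhoY_def)

lemma rho_uminus: "rho n (- a) = - 1 \<cdot>\<^sub>m rho n a"
proof -
  have "- a = uscale (- 1) a" by transfer (rule ueq.refl)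
  thus ?thesis by (simp only: rho_hom)
qed

theorem theorem4:
  fixes n :: nat
  assumes "n \<ge> 1"
  shows "sigma1 n = mat_exp (rho n uX) \<and> sigma2 n = mat_exp (rho n (- uY))"
proof
  have "1 \<cdot>\<^sub>m rhoX n = rhoX n" by (rule eq_matI) auto
  thus "sigma1 n = mat_exp (rho n uX)"
    using mat_exp_smult_rhoX[of 1 n] by (simp add: rho_hom pascal_one)
  \<comment> \<open>The sign of \<open>- uY\<close> originates in the inverse, which is the
    exponential at parameter -1.\<close>
  have "sigma2 n = sharp (mat_exp (- 1 \<cdot>\<^sub>m rhoX n))"
    by (simp only: sigma2_def mat_inverse_sigma1 option.sel mat_exp_smult_rhoX)
  also have "\<dots> = mat_exp (- 1 \<cdot>\<^sub>m rhoY n)"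
    unfolding sharp_smult_rhoX[symmetric]
    by (rule sharp_mat_exp[of _ "n + 1"]) (simp add: rhoX_def)
  finally show "sigma2 n = mat_exp (rho n (- uY))"
    by (simp only: rho_uminus rho_hom)
qed

end
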